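(* Let $K\in\mathbb N$ and let $G:[0,\infty)\to\mathbb R^{K\times K}$ be a symmetric, nonnegative, nonincreasing, convex and commuting decay kernel. Then there exist an orthonormal basis $v_1,\dots,v_K$ of $\mathbb R^K$ and, for each time grid $\mathbb T$, optimal strategies $\boldsymbol\xi^{(i)}\in\mathscr X_{\mathrm{det}}(\mathbb T,v_i)$, $i=1,\dots,K$, such that the following conditions hold. (a) The components of each $\boldsymbol\xi^{(i)}$ consist of buy-only or sell-only strategies. More precisely, for $i,j\in\{1,\dots,K\}$ and $n,m\in\{1,\dots,|\mathbb T|\}$ we have $\xi^{(i),j}_m\,\xi^{(i),j}_n\ge0$, where $\xi^{(i),j}_m$ denotes the $j$-th component of the vector $\xi^{(i)}_m\in\mathbb R^K$. (b) For any given $X_0=\sum_{i=1}^K\alpha_iv_i\in\mathbb R^K$, $\boldsymbol\xi:=\sum_{i=1}^K\alpha_i\boldsymbol\xi^{(i)}$ is an optimal strategy in $\mathscr X_{\mathrm{det}}(\mathbb T,X_0)$.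
   Context: A decay kernel is a continuous function $G:[0,\infty)\to\mathbb R^{K\times K}$. It is symmetric if $G(t)^\top=G(t)$ for all $t$; nonnegative if $x^\top G(t)x\ge0$ for all $x\in\mathbb R^K$, $t\ge0$; nonincreasing (resp. convex) if $t\mapsto x^\top G(t)x$ is nonincreasing (resp. convex) on $[0,\infty)$ for every $x\in\mathbb R^K$; commuting if $G(t)G(s)=G(s)G(t)$ for all $s,t\ge0$. For symmetric $G$ put $\widetilde G(t)=G(|t|)$, $t\in\mathbb R$. A time grid is a finite set $\mathbb T=\{t_1,\dots,t_N\}$, $N=|\mathbb T|\in\mathbb N$, with $0=t_1<t_2<\dots<t_N$. For $X_0\in\mathbb R^K$, $\mathscr X_{\mathrm{det}}(\mathbb T,X_0)$ is the set of (deterministic) $\boldsymbol\xi=(\xi_1,\dots,\xi_N)$ with $\xi_k\in\mathbb R^K$ and $X_0+\sum_{k=1}^N\xi_k=0$. A strategy is optimal in $\mathscr X_{\mathrm{det}}(\mathbb T,X_0)$ if it minimizes $C_{\mathbb T}(\boldsymbol\xi)=\frac12\sum_{k,\ell=1}^N\xi_k^\top\widetilde G(t_k-t_\ell)\xi_\ell$ over $\mathscr X_{\mathrm{det}}(\mathbb T,X_0)$. *)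

theory Defs
  imports "HOL-Analysis.Analysis"
begin

text \<open>
  The dimension \<open>K\<close> is \<open>CARD('k)\<close>. A kernel on \<open>[0, \<infinity>)\<close> is a function on all of \<open>real\<close>
  of which only the values on \<open>{0..}\<close> matter.
\<close>

definition decay_kernel :: "(real \<Rightarrow> real ^ 'k ^ 'k) \<Rightarrow> bool" where
  "decay_kernel G \<longleftrightarrow> continuous_on {0..} G"

definition symmetric_kernel :: "(real \<Rightarrow> real ^ 'k ^ 'k) \<Rightarrow> bool" where
  "symmetric_kernel G \<longleftrightarrow> (\<forall>t\<ge>0. transpose (G t) = G t)"

definition nonneg_kernel :: "(real \<Rightarrow> real ^ 'k ^ 'k) \<Rightarrow> bool" where
  "nonneg_kernel G \<longleftrightarrow> (\<forall>x. \<forall>t\<ge>0. 0 \<le> x \<bullet> (G t *v x))"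

definition nonincreasing_kernel :: "(real \<Rightarrow> real ^ 'k ^ 'k) \<Rightarrow> bool" where
  "nonincreasing_kernel G \<longleftrightarrow> (\<forall>x. antimono_on {0..} (\<lambda>t. x \<bullet> (G t *v x)))"

definition convex_kernel :: "(real \<Rightarrow> real ^ 'k ^ 'k) \<Rightarrow> bool" where
  "convex_kernel G \<longleftrightarrow> (\<forall>x. convex_on {0..} (\<lambda>t. x \<bullet> (G t *v x)))"

definition commuting_kernel :: "(real \<Rightarrow> real ^ 'k ^ 'k) \<Rightarrow> bool" where
  "commuting_kernel G \<longleftrightarrow> (\<forall>s\<ge>0. \<forall>t\<ge>0. G t ** G s = G s ** G t)"

definition even_extension :: "(real \<Rightarrow> real ^ 'k ^ 'k) \<Rightarrow> real \<Rightarrow> real ^ 'k ^ 'k" where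
  "even_extension G t = G \<bar>t\<bar>"

definition time_grid :: "real set \<Rightarrow> bool" where
  "time_grid T \<longleftrightarrow> finite T \<and> 0 \<in> T \<and> (\<forall>t\<in>T. 0 \<le> t)"

text \<open>
  \<open>grid_time T k\<close> is the \<open>k\<close>-th smallest point \<open>t\<^sub>k\<close> of \<open>T\<close>, counted from 1,
  for \<open>1 \<le> k \<le> card T\<close>.
\<close>

definition grid_time :: "real set \<Rightarrow> nat \<Rightarrow> real" where
  "grid_time T k = sorted_list_of_set T ! (k - 1)"

text \<open>
  A strategy \<open>(\<xi>\<^sub>1, \<dots>, \<xi>\<^sub>N)\<close> with \<open>N = card T\<close> is a function on \<open>nat\<close>; its values
  outside \<open>{1..N}\<close> are unconstrained and are never used.
\<close>

definition X_det :: "real set \<Rightarrow> real ^ 'k \<Rightarrow> (nat \<Rightarrow> real ^ 'k) set" where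
  "X_det T X\<^sub>0 = {\<xi>. X\<^sub>0 + (\<Sum>k=1..card T. \<xi> k) = 0}"

definition cost :: "(real \<Rightarrow> real ^ 'k ^ 'k) \<Rightarrow> real set \<Rightarrow> (nat \<Rightarrow> real ^ 'k) \<Rightarrow> real" where
  "cost G T \<xi> = 1 / 2 * (\<Sum>k=1..card T. \<Sum>l=1..card T.
     \<xi> k \<bullet> (even_extension G (grid_time T k - grid_time T l) *v \<xi> l))"

definition optimal_strategy ::
  "(real \<Rightarrow> real ^ 'k ^ 'k) \<Rightarrow> real set \<Rightarrow> real ^ 'k \<Rightarrow> (nat \<Rightarrow> real ^ 'k) \<Rightarrow> bool" where
  "optimal_strategy G T X\<^sub>0 \<xi> \<longleftrightarrow> is_arg_min (cost G T) (\<lambda>\<eta>. \<eta> \<in> X_det T X\<^sub>0) \<xi>"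

definition orthonormal_basis :: "('k \<Rightarrow> real ^ 'k) \<Rightarrow> bool" where
  "orthonormal_basis v \<longleftrightarrow>
     (\<forall>i j. v i \<bullet> v j = (if i = j then 1 else 0)) \<and> span (range v) = UNIV"

end

theory Submission
  imports Defs
begin

text \<open>
  A commuting family of symmetric matrices has a common orthonormal eigenbasis; in its coordinates
  the cost splits into one scalar problem per eigenvector, with kernel \<open>g \<bar>t\<^sub>k - t\<^sub>l\<bar>\<close> for a
  nonincreasing convex \<open>g\<close>. For such a kernel, the potential of a nonnegative strategy is convex
  between consecutive times of its support and decreases away from the outermost ones, so it is
  bounded by its maximum on the support. Hence the minimizer of the energy over the probability simplex has constant
  potential on the whole grid. Removing grid points one at a time, this shows that it also
  minimizes the energy among all signed strategies of the same total: the optimal strategies never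
  change sign.
\<close>

section \<open>Energy minimization under a maximum principle\<close>

text \<open>Dividing by \<open>e\<close> and letting \<open>e\<close> tend to 0 leaves
  \<open>0 \<le> 2 * a\<close>. This is the first-order condition used both for the energy and for
  the Rayleigh quotient.\<close>

lemma nonneg_of_perturbation:
  fixes a b :: real
  assumes "\<And>e. 0 < e \<Longrightarrow> e \<le> 1 \<Longrightarrow> 0 \<le> 2 * e * a + e\<^sup>2 * b"
  shows "0 \<le> a"
proof (rule ccontr)
  assume "\<not> 0 \<le> a"
  \<comment> \<open>So small that the quadratic term cannot offset the negative linear one; the
    \<open>+ 1\<close> keeps the denominator positive.\<close>
  define e where "e = min 1 (- a / (\<bar>b\<bar> + 1))"
  have "0 < - a / (\<bar>b\<bar> + 1)"
    using \<open>\<not> 0 \<le> a\<close> by (intro divide_pos_pos) auto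
  hence e: "0 < e" "e \<le> 1" "e \<le> - a / (\<bar>b\<bar> + 1)"
    by (auto simp: e_def)
  have "e * (\<bar>b\<bar> + 1) \<le> - a"
    using e(3) by (subst pos_le_divide_eq[symmetric]) auto
  moreover have "e * b \<le> e * (\<bar>b\<bar> + 1)"
    using e by (intro mult_left_mono) auto
  ultimately have "2 * a + e * b < 0"
    using \<open>\<not> 0 \<le> a\<close> by linarith
  hence "e * (2 * a + e * b) < 0"
    using e by (simp add: mult_pos_neg)
  thus False
    using assms[of e] e by (simp add: algebra_simps power2_eq_square)
qed

text \<open>Vanishing off \<open>I\<close> makes the set compact among all functions on the index
  type, and makes the simplex of a subset of \<open>I\<close> a face of the simplex of
  \<open>I\<close>.\<close>

definition prob_simplex :: "'i set \<Rightarrow> ('i \<Rightarrow> real) set" where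
  "prob_simplex I = {p. (\<forall>k. 0 \<le> p k) \<and> (\<forall>k. k \<notin> I \<longrightarrow> p k = 0) \<and> sum p I = 1}"

definition potential :: "('i \<Rightarrow> 'i \<Rightarrow> real) \<Rightarrow> 'i set \<Rightarrow> ('i \<Rightarrow> real) \<Rightarrow> 'i \<Rightarrow> real" where
  "potential A I x k = (\<Sum>l\<in>I. A k l * x l)"

definition energy :: "('i \<Rightarrow> 'i \<Rightarrow> real) \<Rightarrow> 'i set \<Rightarrow> ('i \<Rightarrow> real) \<Rightarrow> ('i \<Rightarrow> real) \<Rightarrow> real" where
  "energy A I x y = (\<Sum>k\<in>I. x k * potential A I y k)"

lemma energy_eq_double_sum: "energy A I x y = (\<Sum>k\<in>I. \<Sum>l\<in>I. x k * (A k l * y l))"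
  by (simp add: energy_def potential_def sum_distrib_left)

lemma energy_scale: "energy A I (\<lambda>k. c * x k) (\<lambda>k. c * x k) = c\<^sup>2 * energy A I x x"
  by (simp add: energy_eq_double_sum sum_distrib_left power2_eq_square algebra_simps)

text \<open>By Tychonoff: a closed condition inside a product of unit intervals and
  singletons.\<close>

lemma compact_prob_simplex:
  assumes "finite I"
  shows "compact (prob_simplex I)"
proof -
  define B where "B = (\<Pi>\<^sub>E k\<in>UNIV. if k \<in> I then {0..1::real} else {0})"
  have "compactin (product_topology (\<lambda>_. euclidean) UNIV) B"
    unfolding B_def by (subst compactin_PiE) auto
  hence "compact B"
    by (simp add: euclidean_product_topology)
  moreover have "closed {p :: 'a \<Rightarrow> real. sum p I = 1}"
    by (intro closed_Collect_eq continuous_intros) auto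
  moreover have "prob_simplex I = B \<inter> {p. sum p I = 1}"
  proof -
    have "p k \<le> 1" if "k \<in> I" "\<forall>k. 0 \<le> p k" "sum p I = 1" for p :: "'a \<Rightarrow> real" and k
      using member_le_sum[of k I p] assms that by auto
    thus ?thesis
      by (auto simp: B_def prob_simplex_def PiE_def Pi_def split: if_splits) 
         (metis atLeastAtMost_iff singletonD order_refl)+
  qed
  ultimately show ?thesis
    by (simp add: compact_Int_closed)
qed

text \<open>Isolates what the minimization uses of the kernel: a bound on the support of
  \<open>p\<close> spreads to every index. The point \<open>l\<^sub>0\<close> keeps the support
  nonempty; otherwise the potential could be 0 and a negative \<open>c\<close> would satisfy the
  premises vacuously.\<close>

locale maximum_principle_kernel =
  fixes A :: "'i \<Rightarrow> 'i \<Rightarrow> real"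
  assumes kernel_sym: "A k l = A l k"
    and maximum_principle:
      "\<lbrakk>finite I; \<And>l. 0 \<le> p l; l\<^sub>0 \<in> I; 0 < p l\<^sub>0;
        \<And>l. \<lbrakk>l \<in> I; 0 < p l\<rbrakk> \<Longrightarrow> potential A I p l \<le> c\<rbrakk> \<Longrightarrow> potential A I p k \<le> c"
begin

lemma energy_commute: "energy A I x y = energy A I y x"
proof -
  have "x k * (A k l * y l) = y l * (A l k * x k)" for k l
    using kernel_sym[of k l] by simp
  thus ?thesis
    unfolding energy_eq_double_sum by (subst sum.swap) (simp only:)
qed

lemma energy_add_scaled:
  "energy A I (\<lambda>k. x k + e * y k) (\<lambda>k. x k + e * y k) =
   energy A I x x + 2 * e * energy A I x y + e\<^sup>2 * energy A I y y"
proof -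
  have "energy A I (\<lambda>k. x k + e * y k) (\<lambda>k. x k + e * y k) =
      energy A I x x + e * energy A I x y + e * energy A I y x + e\<^sup>2 * energy A I y y"
    by (simp add: energy_eq_double_sum sum.distrib sum_distrib_left power2_eq_square algebra_simps)
  thus ?thesis
    by (simp add: energy_commute[of I y x])
qed

lemma ex_energy_minimizer:
  assumes "finite I" "I \<noteq> {}"
  obtains x where "x \<in> prob_simplex I"
    and "\<And>p. p \<in> prob_simplex I \<Longrightarrow> energy A I x x \<le> energy A I p p"
proof -
  obtain i where "i \<in> I"
    using assms by auto
  hence "(\<lambda>k. if k = i then 1 else 0) \<in> prob_simplex I"
    using assms by (auto simp: prob_simplex_def)
  hence "prob_simplex I \<noteq> {}"
    by blast
  moreover have "continuous_on (prob_simplex I) (\<lambda>p. energy A I p p)"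
    unfolding energy_eq_double_sum
    by (intro continuous_intros continuous_on_subset[OF continuous_on_product_coordinates]) auto
  ultimately show ?thesis
    using continuous_attains_inf[OF compact_prob_simplex[OF \<open>finite I\<close>]] that by blast
qed

text \<open>
  First-order optimality gives potential at least \<open>c\<close> everywhere, with equality on the support;
  the maximum principle spreads the upper bound \<open>c\<close> from the support to all of \<open>I\<close>.
\<close>

lemma potential_minimizer:
  assumes "finite I" and x: "x \<in> prob_simplex I"
    and min: "\<And>p. p \<in> prob_simplex I \<Longrightarrow> energy A I x x \<le> energy A I p p"
    and "k \<in> I"
  shows "potential A I x k = energy A I x x"
proof -
  let ?c = "energy A I x x"
  have x': "\<And>l. 0 \<le> x l" "\<And>l. l \<notin> I \<Longrightarrow> x l = 0" "sum x I = 1"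
    using x by (auto simp: prob_simplex_def)
  have lower: "?c \<le> potential A I x l" if "l \<in> I" for l
  proof -
    \<comment> \<open>The direction from \<open>x\<close> to the vertex at \<open>l\<close>, so that
      \<open>x + e d\<close> stays in the simplex.\<close>
    define d where "d = (\<lambda>m. (if m = l then 1 else 0) - x m)"
    have "0 \<le> 2 * e * energy A I x d + e\<^sup>2 * energy A I d d" if "0 < e" "e \<le> 1" for e
    proof -
      have "x m * (1 - e) + e * (if m = l then 1 else 0) = x m + e * d m" for m
        by (simp add: d_def algebra_simps)
      moreover have "(\<lambda>m. x m * (1 - e) + e * (if m = l then 1 else 0)) \<in> prob_simplex I"
        using x' that \<open>l \<in> I\<close> \<open>finite I\<close>
        by (auto simp: prob_simplex_def sum.distrib simp flip: sum_distrib_right sum_distrib_left)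
      ultimately have "(\<lambda>m. x m + e * d m) \<in> prob_simplex I"
        by simp
      from min[OF this] show ?thesis
        by (simp add: energy_add_scaled)
    qed
    hence "0 \<le> energy A I x d"
      by (rule nonneg_of_perturbation)
    also have "energy A I x d = energy A I d x"
      by (rule energy_commute)
    also have "\<dots> = potential A I x l - ?c"
      using \<open>l \<in> I\<close> \<open>finite I\<close>
      by (simp add: energy_def d_def left_diff_distrib sum_subtractf if_distrib[of "\<lambda>u. u * _"] cong: if_cong)
    finally show ?thesis
      by simp
  qed
  \<comment> \<open>Complementary slackness: the average of the potential under the weights
    \<open>x\<close> is \<open>?c\<close> itself, so the nonnegative excesses vanish wherever
    \<open>x\<close> is positive.\<close>
  have "(\<Sum>l\<in>I. x l * (potential A I x l - ?c)) = 0"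
    using x' by (simp add: right_diff_distrib sum_subtractf energy_def flip: sum_distrib_right)
  moreover have "0 \<le> x l * (potential A I x l - ?c)" if "l \<in> I" for l
    using x' lower[OF that] by simp
  ultimately have "\<forall>l\<in>I. x l * (potential A I x l - ?c) = 0"
    using sum_nonneg_eq_0_iff[OF \<open>finite I\<close>, of "\<lambda>l. x l * (potential A I x l - ?c)"] by simp
  hence upper: "potential A I x l \<le> ?c" if "l \<in> I" "0 < x l" for l
    using that by fastforce
  obtain l\<^sub>0 where "l\<^sub>0 \<in> I" "0 < x l\<^sub>0"
    using x' by (metis less_eq_real_def sum.neutral zero_neq_one)
  hence "potential A I x k \<le> ?c"
    using maximum_principle[of I x l\<^sub>0 ?c k] \<open>finite I\<close> x'(1) upper by blast
  with lower[OF \<open>k \<in> I\<close>] show ?thesis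
    by linarith
qed

text \<open>
  The induction removes from \<open>I\<close> a point \<open>k\<close> of the support of the minimizer \<open>x\<close>:
  \<open>y - (y k / x k) x\<close> vanishes at \<open>k\<close>, and the energy of \<open>x\<close> against anything is explicit
  because its potential is constant.
\<close>

lemma energy_lower_bound:
  assumes "finite I" and "\<And>p. p \<in> prob_simplex I \<Longrightarrow> c \<le> energy A I p p"
  shows "c * (sum y I)\<^sup>2 \<le> energy A I y y"
  using assms
proof (induction I arbitrary: c y rule: finite_psubset_induct)
  case (psubset I)
  show ?case
  proof (cases "I = {}")
    case True
    thus ?thesis
      by (simp add: energy_def)
  next
    case False
    then obtain x where x: "x \<in> prob_simplex I"
      and min: "\<And>p. p \<in> prob_simplex I \<Longrightarrow> energy A I x x \<le> energy A I p p"
      using ex_energy_minimizer psubset.hyps by blast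
    have pot: "potential A I x k = energy A I x x" if "k \<in> I" for k
      using potential_minimizer[OF psubset.hyps x min that] .
    let ?c = "energy A I x x"
    have sum_x: "sum x I = 1" and "\<And>l. 0 \<le> x l"
      using x by (auto simp: prob_simplex_def)
    then obtain k where k: "k \<in> I" "0 < x k"
      by (metis less_eq_real_def sum.neutral zero_neq_one)
    have drop: "energy A (I - {k}) z z = energy A I z z" "sum z (I - {k}) = sum z I"
      if "z k = 0" for z
    proof -
      have pot': "potential A (I - {k}) z l = potential A I z l" for l
        unfolding potential_def using psubset.hyps that by (intro sum.mono_neutral_left) auto
      show "energy A (I - {k}) z z = energy A I z z"
        unfolding energy_def pot' using psubset.hyps that by (intro sum.mono_neutral_left) auto
      show "sum z (I - {k}) = sum z I"
        using psubset.hyps that by (intro sum.mono_neutral_left) auto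
    qed
    define \<mu> where "\<mu> = y k / x k"
    define z where "z = (\<lambda>l. y l - \<mu> * x l)"
    have "z k = 0"
      using k by (simp add: z_def \<mu>_def)
    \<comment> \<open>The smaller simplex is a face of the larger one, so the induction hypothesis
      applies with the constant \<open>?c\<close> of the larger set.\<close>
    have "?c \<le> energy A (I - {k}) p p" if "p \<in> prob_simplex (I - {k})" for p
    proof -
      have "p k = 0"
        using that by (auto simp: prob_simplex_def)
      moreover have "p \<in> prob_simplex I"
        using that drop(2)[of p, OF \<open>p k = 0\<close>] by (auto simp: prob_simplex_def)
      ultimately show ?thesis
        using min drop(1) by simp
    qed
    hence "?c * (sum z (I - {k}))\<^sup>2 \<le> energy A (I - {k}) z z"
      using k by (intro psubset.IH) auto
    hence z: "?c * (sum z I)\<^sup>2 \<le> energy A I z z"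
      using drop[of z, OF \<open>z k = 0\<close>] by simp
    have sum_z: "sum z I = sum y I - \<mu>"
      using sum_x by (simp add: z_def sum_subtractf flip: sum_distrib_left)
    have "energy A I z x = ?c * sum z I"
      unfolding energy_def[of A I z x] using pot by (simp add: mult.commute flip: sum_distrib_right)
    moreover have "energy A I y y = energy A I z z + 2 * \<mu> * energy A I z x + \<mu>\<^sup>2 * ?c"
      using energy_add_scaled[of I z \<mu> x] by (simp add: z_def)
    \<comment> \<open>The cross and square terms in \<open>\<mu>\<close> agree with those of the
      energy, which leaves only the inequality for \<open>z\<close>.\<close>
    moreover have "?c * (sum y I)\<^sup>2 = ?c * (sum z I)\<^sup>2 + 2 * \<mu> * (?c * sum z I) + \<mu>\<^sup>2 * ?c"
      unfolding sum_z by (simp add: power2_eq_square algebra_simps)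
    ultimately have "?c * (sum y I)\<^sup>2 \<le> energy A I y y"
      using z by simp
    moreover have "c * (sum y I)\<^sup>2 \<le> ?c * (sum y I)\<^sup>2"
      using psubset.prems[OF x] by (intro mult_right_mono) auto
    ultimately show ?thesis
      by linarith
  qed
qed

text \<open>The square makes one bound cover signed functions of every total, so the same
  \<open>x\<close> serves all multiples.\<close>

lemma ex_nonneg_energy_minimizer:
  assumes "finite I" "I \<noteq> {}"
  obtains x where "x \<in> prob_simplex I"
    and "\<And>y. energy A I x x * (sum y I)\<^sup>2 \<le> energy A I y y"
  using ex_energy_minimizer[OF assms] energy_lower_bound[OF assms(1)] by metis

end

section \<open>Convex nonincreasing functions of the distance\<close>

text \<open>As \<open>p\<close> is nonnegative, bounding the kernel at \<open>k\<close> by a convex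
  combination of the kernels at two support points bounds the potential in the same way. Convexity
  yields this between support points, monotonicity outside them.\<close>

lemma maximum_principle_convex_kernel:
  fixes g :: "real \<Rightarrow> real" and t :: "'i \<Rightarrow> real"
  assumes mono: "antimono_on {0..} g" and conv: "convex_on {0..} g"
  shows "maximum_principle_kernel (\<lambda>k l. g \<bar>t k - t l\<bar>)"
proof
  show "g \<bar>t k - t l\<bar> = g \<bar>t l - t k\<bar>" for k l
    by (simp add: abs_minus_commute)
next
  fix I :: "'i set" and p :: "'i \<Rightarrow> real" and l\<^sub>0 k c
  let ?u = "potential (\<lambda>k l. g \<bar>t k - t l\<bar>) I p"
  assume I: "finite I" and p: "\<And>l. 0 \<le> p l" and l0: "l\<^sub>0 \<in> I" "0 < p l\<^sub>0"
    and le: "\<And>l. \<lbrakk>l \<in> I; 0 < p l\<rbrakk> \<Longrightarrow> ?u l \<le> c"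
  define L where "L = {l \<in> I. 0 < p l \<and> t l \<le> t k}"
  define R where "R = {l \<in> I. 0 < p l \<and> t k \<le> t l}"
  have fin: "finite L" "finite R"
    using I by (auto simp: L_def R_def)
  have comb: "?u k \<le> c"
    if th: "0 \<le> \<theta>" "\<theta> \<le> 1" and ab: "a \<in> I" "0 < p a" "b \<in> I" "0 < p b"
      and g: "\<And>l. \<lbrakk>l \<in> I; 0 < p l\<rbrakk> \<Longrightarrow>
        g \<bar>t k - t l\<bar> \<le> (1 - \<theta>) * g \<bar>t a - t l\<bar> + \<theta> * g \<bar>t b - t l\<bar>" for \<theta> a b
  proof -
    have "g \<bar>t k - t l\<bar> * p l \<le> ((1 - \<theta>) * g \<bar>t a - t l\<bar> + \<theta> * g \<bar>t b - t l\<bar>) * p l"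
      if "l \<in> I" for l
      using p[of l] g[OF that] by (cases "p l = 0") (auto intro!: mult_right_mono)
    hence "?u k \<le> (\<Sum>l\<in>I. ((1 - \<theta>) * g \<bar>t a - t l\<bar> + \<theta> * g \<bar>t b - t l\<bar>) * p l)"
      unfolding potential_def by (rule sum_mono)
    also have "\<dots> = (1 - \<theta>) * ?u a + \<theta> * ?u b"
      by (simp add: potential_def distrib_right sum.distrib sum_distrib_left mult.assoc)
    also have "\<dots> \<le> (1 - \<theta>) * c + \<theta> * c"
      using th le ab by (intro add_mono mult_left_mono) auto
    finally show ?thesis
      by (simp add: algebra_simps)
  qed
  have closer: "?u k \<le> c"
    if "a \<in> I" "0 < p a" "\<And>l. \<lbrakk>l \<in> I; 0 < p l\<rbrakk> \<Longrightarrow> \<bar>t a - t l\<bar> \<le> \<bar>t k - t l\<bar>" for a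
    using that monotone_onD[OF mono] by (intro comb[of 0 a a]) auto
  show "?u k \<le> c"
  \<comment> \<open>If one side is empty, \<open>t k\<close> lies beyond all support times, and the
    nearest support point is closer than \<open>k\<close> to every other one.\<close>
  proof (cases "L = {} \<or> R = {}")
    case True
    thus ?thesis
    proof
      assume "L = {}"
      hence k: "t k < t l" if "l \<in> I" "0 < p l" for l
        using that by (force simp: L_def)
      hence "R \<noteq> {}"
        using l0 by (force simp: R_def)
      then obtain a where "a \<in> R" "\<And>l. l \<in> R \<Longrightarrow> t a \<le> t l"
        using fin by (metis arg_min_if_finite(1) arg_min_least)
      thus ?thesis
        using k by (intro closer[of a]) (force simp: R_def)+
    next
      assume "R = {}"
      hence k: "t l < t k" if "l \<in> I" "0 < p l" for l
        using that by (force simp: R_def)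
      hence "L \<noteq> {}"
        using l0 by (force simp: L_def)
      then obtain a where "a \<in> L" "\<And>l. l \<in> L \<Longrightarrow> - t a \<le> - t l"
        using fin by (metis arg_min_if_finite(1) arg_min_least[where f = "\<lambda>l. - t l"])
      thus ?thesis
        using k by (intro closer[of a]) (force simp: L_def)+
    qed
  next
    case False
    \<comment> \<open>\<open>a\<close> is a latest support point up to \<open>t k\<close> and
      \<open>b\<close> an earliest one from \<open>t k\<close> on.\<close>
    obtain a where a: "a \<in> L" "\<And>l. l \<in> L \<Longrightarrow> - t a \<le> - t l"
      using fin False by (metis arg_min_if_finite(1) arg_min_least[where f = "\<lambda>l. - t l"])
    obtain b where b: "b \<in> R" "\<And>l. l \<in> R \<Longrightarrow> t b \<le> t l"
      using fin False by (metis arg_min_if_finite(1) arg_min_least)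
    have ab: "t a \<le> t k" "t k \<le> t b"
      using a b by (auto simp: L_def R_def)
    \<comment> \<open>If \<open>t a = t b\<close>, division by zero gives
      \<open>\<theta> = 0\<close>, which is still right because then
      \<open>t k = t a\<close>.\<close>
    define \<theta> where "\<theta> = (t k - t a) / (t b - t a)"
    have th: "0 \<le> \<theta>" "\<theta> \<le> 1"
      using ab by (auto simp: \<theta>_def divide_simps)
    have tk: "t k = (1 - \<theta>) * t a + \<theta> * t b"
    proof -
      have "\<theta> * (t b - t a) = t k - t a"
        using ab by (cases "t a = t b") (auto simp: \<theta>_def)
      thus ?thesis
        by (simp add: algebra_simps)
    qed
    show ?thesis
    proof (rule comb[of \<theta> a b])
      fix l assume l: "l \<in> I" "0 < p l"
      \<comment> \<open>No support point lies strictly between \<open>t a\<close> and \<open>t b\<close>,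
        so the distance to \<open>t l\<close> is affine there.\<close>
      have "t l \<le> t a \<or> t b \<le> t l"
        using a(2)[of l] b(2)[of l] l by (force simp: L_def R_def)
      hence "\<bar>t k - t l\<bar> = (1 - \<theta>) * \<bar>t a - t l\<bar> + \<theta> * \<bar>t b - t l\<bar>"
      proof
        assume "t l \<le> t a"
        hence "\<bar>t k - t l\<bar> = t k - t l" "\<bar>t a - t l\<bar> = t a - t l" "\<bar>t b - t l\<bar> = t b - t l"
          using ab by auto
        thus ?thesis
          by (simp add: tk algebra_simps)
      next
        assume "t b \<le> t l"
        hence "\<bar>t k - t l\<bar> = t l - t k" "\<bar>t a - t l\<bar> = t l - t a" "\<bar>t b - t l\<bar> = t l - t b"
          using ab by auto
        thus ?thesis
          by (simp add: tk algebra_simps)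
      qed
      thus "g \<bar>t k - t l\<bar> \<le> (1 - \<theta>) * g \<bar>t a - t l\<bar> + \<theta> * g \<bar>t b - t l\<bar>"
        using convex_onD[OF conv th, of "\<bar>t a - t l\<bar>" "\<bar>t b - t l\<bar>"] by simp
    qed (use th a b in \<open>auto simp: L_def R_def\<close>)
  qed
qed

section \<open>Common eigenbases of commuting symmetric matrices\<close>

text \<open>A maximizer of the quadratic form of \<open>f\<close> on the unit sphere of
  \<open>V\<close> is an eigenvector, with the maximum as eigenvalue.\<close>

lemma ex_eigenvector_selfadjoint:
  fixes f :: "'a::euclidean_space \<Rightarrow> 'a"
  assumes "linear f" and sa: "\<And>x y. f x \<bullet> y = x \<bullet> f y"
    and V: "subspace V" "V \<noteq> {0}" and inv: "\<And>x. x \<in> V \<Longrightarrow> f x \<in> V"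
  obtains x c where "x \<in> V" "norm x = 1" "f x = c *\<^sub>R x"
proof -
  interpret f: linear f by fact
  let ?K = "V \<inter> sphere 0 1"
  have normalize: "y /\<^sub>R norm y \<in> ?K" if "y \<in> V" "y \<noteq> 0" for y
    using that V by (simp add: subspace_scale)
  have "compact ?K"
    using V by (simp add: closed_subspace closed_Int_compact)
  moreover have "?K \<noteq> {}"
    using normalize V subspace_0 by blast
  moreover have "continuous_on ?K (\<lambda>y. y \<bullet> f y)"
    using \<open>linear f\<close> by (intro continuous_intros linear_continuous_on) (simp add: linear_conv_bounded_linear)
  ultimately obtain x where x: "x \<in> ?K" and max: "\<And>y. y \<in> ?K \<Longrightarrow> y \<bullet> f y \<le> x \<bullet> f x"
    using continuous_attains_sup by metis
  define c where "c = x \<bullet> f x"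
  \<comment> \<open>Homogeneity extends the bound to all of \<open>V\<close>, so perturbations of
    \<open>x\<close> need not be normalized.\<close>
  have rayleigh: "y \<bullet> f y \<le> c * (y \<bullet> y)" if "y \<in> V" for y
  proof (cases "y = 0")
    case False
    define n where "n = inverse (norm y)"
    have n: "n * norm y = 1"
      using False by (simp add: n_def)
    have "n * (n * (y \<bullet> f y)) \<le> c"
      using max[OF normalize[OF that False]] by (simp add: c_def f.scaleR n_def)
    hence "(n * (n * (y \<bullet> f y))) * (norm y)\<^sup>2 \<le> c * (norm y)\<^sup>2"
      by (intro mult_right_mono) auto
    also have "(n * (n * (y \<bullet> f y))) * (norm y)\<^sup>2 = (n * norm y)\<^sup>2 * (y \<bullet> f y)"
      by (simp add: power2_eq_square)
    finally show ?thesis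
      by (simp add: n power2_norm_eq_inner)
  qed simp
  \<comment> \<open>Varying \<open>x\<close> along the residual \<open>s\<close> gives a first-order
    coefficient of \<open>- (s \<bullet> s)\<close>, which forces \<open>s = 0\<close>.\<close>
  define s where "s = f x - c *\<^sub>R x"
  have "s \<in> V"
    using x V inv by (simp add: s_def subspace_diff subspace_scale)
  have "0 \<le> 2 * e * (- (s \<bullet> s)) + e\<^sup>2 * (c * (s \<bullet> s) - s \<bullet> f s)" for e
  proof -
    have "x + e *\<^sub>R s \<in> V"
      using x \<open>s \<in> V\<close> V by (simp add: subspace_add subspace_scale)
    hence "0 \<le> c * ((x + e *\<^sub>R s) \<bullet> (x + e *\<^sub>R s)) - (x + e *\<^sub>R s) \<bullet> f (x + e *\<^sub>R s)"
      using rayleigh by simp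
    also have "\<dots> = (c * (x \<bullet> x) - x \<bullet> f x) + 2 * e * (c * (x \<bullet> s) - f x \<bullet> s)
        + e\<^sup>2 * (c * (s \<bullet> s) - s \<bullet> f s)"
    proof -
      have "x \<bullet> f s = f x \<bullet> s" "s \<bullet> f x = f x \<bullet> s" "s \<bullet> x = x \<bullet> s"
        using sa[of x s] by (simp_all add: inner_commute)
      thus ?thesis
        by (simp add: f.add f.scaleR inner_add_left inner_add_right power2_eq_square algebra_simps)
    qed
    also have "x \<bullet> x = 1"
      using x by (simp add: dot_square_norm)
    also have "c * (x \<bullet> s) - f x \<bullet> s = - (s \<bullet> s)"
      by (simp add: s_def inner_diff_left)
    finally show ?thesis
      by (simp add: c_def)
  qed
  hence "0 \<le> - (s \<bullet> s)"
    using nonneg_of_perturbation[of "- (s \<bullet> s)" "c * (s \<bullet> s) - s \<bullet> f s"] by blast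
  hence "s \<bullet> s = 0"
    using inner_ge_zero[of s] by linarith
  hence "s = 0"
    by simp
  thus ?thesis
    using that[of x c] x by (simp add: s_def)
qed

text \<open>If some \<open>f\<close> is not scalar on \<open>V\<close>, an eigenspace of
  \<open>f\<close> in \<open>V\<close> is proper and nonzero, and commutation keeps it invariant
  under the whole family. Induction is on the dimension, so \<open>F\<close> may be
  infinite.\<close>

lemma ex_common_eigenvector:
  fixes F :: "('a::euclidean_space \<Rightarrow> 'a) set"
  assumes lin: "\<And>f. f \<in> F \<Longrightarrow> linear f"
    and sa: "\<And>f x y. f \<in> F \<Longrightarrow> f x \<bullet> y = x \<bullet> f y"
    and comm: "\<And>f g x. \<lbrakk>f \<in> F; g \<in> F\<rbrakk> \<Longrightarrow> f (g x) = g (f x)"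
    and "subspace V" "V \<noteq> {0}" "\<And>f x. \<lbrakk>f \<in> F; x \<in> V\<rbrakk> \<Longrightarrow> f x \<in> V"
  shows "\<exists>x\<in>V. norm x = 1 \<and> (\<forall>f\<in>F. \<exists>c. f x = c *\<^sub>R x)"
  using assms(4-6)
proof (induction "dim V" arbitrary: V rule: less_induct)
  case less
  note V = less.prems
  show ?case
  proof (cases "\<forall>f\<in>F. \<exists>c. \<forall>x\<in>V. f x = c *\<^sub>R x")
    case True
    obtain y where "y \<in> V" "y \<noteq> 0"
      using V(1,2) subspace_0 by blast
    hence "y /\<^sub>R norm y \<in> V" "norm (y /\<^sub>R norm y) = 1"
      using V(1) by (simp_all add: subspace_scale)
    thus ?thesis
      using True by (metis (no_types))
  next
    case False
    then obtain f where f: "f \<in> F" "\<And>c. \<exists>x\<in>V. f x \<noteq> c *\<^sub>R x"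
      by blast
    obtain x c where x: "x \<in> V" "norm x = 1" "f x = c *\<^sub>R x"
      by (rule ex_eigenvector_selfadjoint[OF lin[OF f(1)] sa[OF f(1)] V(1,2) V(3)[OF f(1)]])
    define E where "E = {y \<in> V. f y = c *\<^sub>R y}"
    interpret f: linear f
      using lin f by blast
    have "subspace E"
      using V(1) by (simp add: E_def subspace_def f.add f.scaleR scaleR_add_right)
    moreover have "E \<subseteq> V" "E \<noteq> V"
      using f(2)[of c] by (auto simp: E_def)
    ultimately have E: "subspace E" "E \<subseteq> V" "E \<noteq> V" .
    have dim: "dim E < dim V"
      using E V(1) subspace_dim_equal[of E V] by (meson not_less)
    have "x \<in> E" "x \<noteq> 0"
      using x by (auto simp: E_def)
    hence "E \<noteq> {0}"
      by blast
    have inv: "g y \<in> E" if "g \<in> F" "y \<in> E" for g y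
    proof -
      have "f (g y) = g (c *\<^sub>R y)"
        using comm[OF f(1) that(1)] that(2) by (simp add: E_def)
      also have "\<dots> = c *\<^sub>R g y"
        by (rule linear_scale[OF lin[OF that(1)]])
      finally show ?thesis
        using V(3)[OF that(1), of y] that(2) by (simp add: E_def)
    qed
    have "\<exists>x\<in>E. norm x = 1 \<and> (\<forall>f\<in>F. \<exists>c. f x = c *\<^sub>R x)"
      by (rule less.hyps[OF dim E(1) \<open>E \<noteq> {0}\<close>]) (rule inv)
    thus ?thesis
      using E(2) by blast
  qed
qed

text \<open>Common eigenvectors are found one at a time in the orthogonal complement of the earlier
  ones, which is invariant because the matrices are symmetric.\<close>

lemma ex_common_eigenbasis:
  fixes F :: "(real ^ 'k ^ 'k) set"
  assumes sym: "\<And>M. M \<in> F \<Longrightarrow> transpose M = M"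
    and comm: "\<And>M N. \<lbrakk>M \<in> F; N \<in> F\<rbrakk> \<Longrightarrow> M ** N = N ** M"
  obtains v :: "'k \<Rightarrow> real ^ 'k"
  where "orthonormal_basis v" "\<And>M i. M \<in> F \<Longrightarrow> \<exists>c. M *v v i = c *\<^sub>R v i"
proof -
  have sa: "(M *v x) \<bullet> y = x \<bullet> (M *v y)" if "M \<in> F" for M x y
    using sym[OF that] by (metis dot_lmul_matrix transpose_matrix_vector)
  define P where "P b \<longleftrightarrow> norm b = 1 \<and> (\<forall>M\<in>F. \<exists>c. M *v b = c *\<^sub>R b)" for b
  have ex: "\<exists>B. finite B \<and> card B = n \<and> pairwise orthogonal B \<and> (\<forall>b\<in>B. P b)"
    if "n \<le> CARD('k)" for n
    using that
  proof (induction n)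
    case 0
    show ?case
      by (intro exI[of _ "{}"]) auto
  next
    case (Suc n)
    then obtain B where B: "finite B" "card B = n" "pairwise orthogonal B" "\<forall>b\<in>B. P b"
      by auto
    define W where "W = {w. \<forall>b\<in>B. orthogonal w b}"
    have "dim B < DIM(real ^ 'k)"
      using dim_le_card'[OF B(1)] B(2) Suc.prems by simp
    then obtain w where "w \<noteq> 0" "\<And>y. y \<in> span B \<Longrightarrow> orthogonal w y"
      using orthogonal_to_subspace_exists[of B] by metis
    hence "w \<in> W"
      by (simp add: W_def span_base)
    hence "W \<noteq> {0}"
      using \<open>w \<noteq> 0\<close> by blast
    have "subspace W"
      by (auto simp: W_def subspace_def orthogonal_def inner_add_left)
    have inv: "M *v x \<in> W" if "M \<in> F" "x \<in> W" for M x
    proof -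
      have "(M *v x) \<bullet> b = 0" if "b \<in> B" for b
      proof -
        obtain c where "M *v b = c *\<^sub>R b"
          using B(4) \<open>b \<in> B\<close> \<open>M \<in> F\<close> unfolding P_def by blast
        thus ?thesis
          using sa[OF \<open>M \<in> F\<close>, of x b] \<open>x \<in> W\<close> \<open>b \<in> B\<close> by (simp add: W_def orthogonal_def)
      qed
      thus ?thesis
        by (simp add: W_def orthogonal_def)
    qed
    have "\<exists>x\<in>W. norm x = 1 \<and> (\<forall>f\<in>(*v) ` F. \<exists>c. f x = c *\<^sub>R x)"
    proof (rule ex_common_eigenvector)
      show "linear f" if "f \<in> (*v) ` F" for f
        using that by auto
      show "f x \<bullet> y = x \<bullet> f y" if f: "f \<in> (*v) ` F" for f x y
      proof -
        obtain M where "M \<in> F" "f = (*v) M"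
          using f by blast
        thus ?thesis
          using sa[of M x y] by simp
      qed
      show "f (g x) = g (f x)" if fg: "f \<in> (*v) ` F" "g \<in> (*v) ` F" for f g x
      proof -
        obtain M N where "M \<in> F" "N \<in> F" "f = (*v) M" "g = (*v) N"
          using fg by blast
        thus ?thesis
          using comm[of M N] by (simp add: matrix_vector_mul_assoc)
      qed
      show "f x \<in> W" if fx: "f \<in> (*v) ` F" "x \<in> W" for f x
      proof -
        obtain M where "M \<in> F" "f = (*v) M"
          using fx by blast
        thus ?thesis
          using inv[of M x] fx by simp
      qed
    qed fact+
    hence "\<exists>x\<in>W. P x"
      by (simp add: P_def)
    then obtain x where x: "x \<in> W" "P x"
      by blast
    \<comment> \<open>Otherwise \<open>x\<close> would be orthogonal to itself, against its norm
      1.\<close>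
    have "x \<notin> B"
      using x by (auto simp: W_def P_def orthogonal_def)
    moreover have "pairwise orthogonal (insert x B)"
      using B(3) x(1) by (auto simp: pairwise_insert W_def orthogonal_commute)
    ultimately show ?case
      using B x by (intro exI[of _ "insert x B"]) auto
  qed
  obtain B :: "(real ^ 'k) set" where B: "finite B" "card B = CARD('k)" "pairwise orthogonal B"
    "\<And>b. b \<in> B \<Longrightarrow> P b"
    using ex[OF order_refl] by blast
  have "\<exists>h. bij_betw h (UNIV :: 'k set) B"
    using B(1,2) by (intro finite_same_card_bij) simp_all
  then obtain v where v: "bij_betw v (UNIV :: 'k set) B"
    by blast
  have vB: "v i \<in> B" for i
    using bij_betwE[OF v] by simp
  have v_inj: "v i \<noteq> v j" if "i \<noteq> j" for i j
    using bij_betw_imp_inj_on[OF v] that by (simp add: inj_eq)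
  have norm: "norm b = 1" if "b \<in> B" for b
    using B(4)[OF that] by (simp add: P_def)
  hence "0 \<notin> B"
    by (metis norm_zero zero_neq_one)
  hence "independent B"
    using B(3) by (rule pairwise_orthogonal_independent[rotated])
  hence "span B = UNIV"
    using B(2) dim_eq_full[of B] by (simp add: dim_eq_card_independent)
  moreover have "v i \<bullet> v j = (if i = j then 1 else 0)" for i j
  proof (cases "i = j")
    case True
    thus ?thesis
      using norm[OF vB, of j] by (simp add: dot_square_norm)
  next
    case False
    thus ?thesis
      using pairwiseD[OF B(3) vB vB v_inj[OF False]] by (simp add: orthogonal_def)
  qed
  ultimately have "orthonormal_basis v"
    using v by (simp add: orthonormal_basis_def bij_betw_def)
  show ?thesis
  proof (rule that[of v])
    show "\<exists>c. M *v v i = c *\<^sub>R v i" if "M \<in> F" for M i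
      using B(4)[OF vB, of i] that by (simp add: P_def)
  qed fact
qed

section \<open>Diagonalization of the cost\<close>

text \<open>The difference of the two sides is orthogonal to every \<open>v i\<close>, hence to
  their span, which contains it.\<close>

lemma orthonormal_basis_expand:
  assumes "orthonormal_basis v"
  shows "x = (\<Sum>i\<in>UNIV. (v i \<bullet> x) *\<^sub>R v i)"
proof -
  let ?d = "x - (\<Sum>i\<in>UNIV. (v i \<bullet> x) *\<^sub>R v i)"
  have vv: "v i \<bullet> v j = (if i = j then 1 else 0)" for i j
    using assms by (simp add: orthonormal_basis_def)
  have "orthogonal ?d y" if "y \<in> range v" for y
    using that by (auto simp: orthogonal_def inner_diff_left inner_sum_left inner_commute[of x]
        vv if_distrib cong: if_cong)
  moreover have "?d \<in> span (range v)"
    using assms by (simp add: orthonormal_basis_def)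
  ultimately have "orthogonal ?d ?d"
    by (rule orthogonal_to_span[rotated])
  thus ?thesis
    by (simp only: orthogonal_self right_minus_eq)
qed

lemma inner_matrix_vector_eigenbasis:
  fixes v :: "'k \<Rightarrow> real ^ 'k"
  assumes v: "orthonormal_basis v" and eig: "\<And>i. M *v v i = c i *\<^sub>R v i"
  shows "x \<bullet> (M *v y) = (\<Sum>i\<in>UNIV. (v i \<bullet> x) * (c i * (v i \<bullet> y)))"
proof -
  have "M *v y = M *v (\<Sum>i\<in>UNIV. (v i \<bullet> y) *\<^sub>R v i)"
    by (rule arg_cong[where f = "(*v) M", OF orthonormal_basis_expand[OF v]])
  also have "\<dots> = (\<Sum>i\<in>UNIV. (v i \<bullet> y) *\<^sub>R c i *\<^sub>R v i)"
    by (simp add: linear_sum[OF matrix_vector_mul_linear] matrix_vector_mult_scaleR eig)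
  finally show ?thesis
    by (simp add: inner_sum_right inner_commute[of x] mult_ac)
qed

text \<open>The liquidation constraint splits along the same coordinates, so each eigendirection can
  be minimized separately.\<close>

lemma cost_eq_sum_energy:
  fixes v :: "'k \<Rightarrow> real ^ 'k"
  assumes "orthonormal_basis v" and "\<And>t i. 0 \<le> t \<Longrightarrow> G t *v v i = g i t *\<^sub>R v i"
  shows "cost G T \<xi> = 1 / 2 * (\<Sum>i\<in>UNIV.
    energy (\<lambda>k l. g i \<bar>grid_time T k - grid_time T l\<bar>) {1..card T} (\<lambda>k. v i \<bullet> \<xi> k) (\<lambda>k. v i \<bullet> \<xi> k))"
proof -
  let ?e = "\<lambda>i k l. (v i \<bullet> \<xi> k) * (g i \<bar>grid_time T k - grid_time T l\<bar> * (v i \<bullet> \<xi> l))"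
  have "\<xi> k \<bullet> (G \<bar>grid_time T k - grid_time T l\<bar> *v \<xi> l) = (\<Sum>i\<in>UNIV. ?e i k l)" for k l
    by (rule inner_matrix_vector_eigenbasis[OF assms(1)]) (rule assms(2)[OF abs_ge_zero])
  hence "cost G T \<xi> = 1 / 2 * (\<Sum>k=1..card T. \<Sum>l=1..card T. \<Sum>i\<in>UNIV. ?e i k l)"
    by (simp only: cost_def even_extension_def)
  also have "(\<Sum>k=1..card T. \<Sum>l=1..card T. \<Sum>i\<in>UNIV. ?e i k l) =
      (\<Sum>k=1..card T. \<Sum>i\<in>UNIV. \<Sum>l=1..card T. ?e i k l)"
    by (intro sum.cong refl sum.swap)
  also have "\<dots> = (\<Sum>i\<in>UNIV. \<Sum>k=1..card T. \<Sum>l=1..card T. ?e i k l)"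
    by (rule sum.swap)
  finally show ?thesis
    by (simp only: energy_eq_double_sum)
qed

section \<open>Optimal strategies\<close>

theorem proposition2p18:
  fixes G :: "real \<Rightarrow> real ^ 'k ^ 'k"
  assumes "decay_kernel G"
    and "symmetric_kernel G"
    and "nonneg_kernel G"
    and "nonincreasing_kernel G"
    and "convex_kernel G"
    and "commuting_kernel G"
  shows "\<exists>v :: 'k \<Rightarrow> real ^ 'k. orthonormal_basis v \<and>
    (\<forall>T. time_grid T \<longrightarrow>
      (\<exists>\<Xi> :: 'k \<Rightarrow> nat \<Rightarrow> real ^ 'k.
        (\<forall>i. optimal_strategy G T (v i) (\<Xi> i)) \<and>
        (\<forall>i j. \<forall>n\<in>{1..card T}. \<forall>m\<in>{1..card T}. 0 \<le> \<Xi> i m $ j * \<Xi> i n $ j) \<and>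
        (\<forall>X\<^sub>0 \<alpha>. X\<^sub>0 = (\<Sum>i\<in>UNIV. \<alpha> i *\<^sub>R v i) \<longrightarrow>
          optimal_strategy G T X\<^sub>0 (\<lambda>k. \<Sum>i\<in>UNIV. \<alpha> i *\<^sub>R \<Xi> i k))))"
proof -
  have "transpose M = M" if "M \<in> G ` {0..}" for M
    using that \<open>symmetric_kernel G\<close> by (auto simp: symmetric_kernel_def)
  moreover have "M ** N = N ** M" if "M \<in> G ` {0..}" "N \<in> G ` {0..}" for M N
    using that \<open>commuting_kernel G\<close> by (auto simp: commuting_kernel_def)
  ultimately obtain v :: "'k \<Rightarrow> real ^ 'k" where v: "orthonormal_basis v"
    and "\<And>M i. M \<in> G ` {0..} \<Longrightarrow> \<exists>c. M *v v i = c *\<^sub>R v i"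
    using ex_common_eigenbasis[of "G ` {0..}"] by blast
  hence ex: "\<exists>c. G t *v v i = c *\<^sub>R v i" if "0 \<le> t" for t i
    using that by simp
  have vv: "v i \<bullet> v j = (if i = j then 1 else 0)" for i j
    using v by (simp add: orthonormal_basis_def)
  \<comment> \<open>The eigenvalue is written as a quadratic form at the unit vector
    \<open>v i\<close>, so that monotonicity and convexity of \<open>G\<close> transfer directly to
    \<open>g i\<close>.\<close>
  define g where "g i t = v i \<bullet> (G t *v v i)" for i t
  have eig: "G t *v v i = g i t *\<^sub>R v i" if "0 \<le> t" for t i
  proof -
    obtain c where "G t *v v i = c *\<^sub>R v i"
      using ex[OF \<open>0 \<le> t\<close>] by blast
    thus ?thesis
      by (simp add: g_def vv)
  qed
  have "\<exists>\<Xi> :: 'k \<Rightarrow> nat \<Rightarrow> real ^ 'k.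
        (\<forall>i. optimal_strategy G T (v i) (\<Xi> i)) \<and>
        (\<forall>i j. \<forall>n\<in>{1..card T}. \<forall>m\<in>{1..card T}. 0 \<le> \<Xi> i m $ j * \<Xi> i n $ j) \<and>
        (\<forall>X\<^sub>0 \<alpha>. X\<^sub>0 = (\<Sum>i\<in>UNIV. \<alpha> i *\<^sub>R v i) \<longrightarrow>
          optimal_strategy G T X\<^sub>0 (\<lambda>k. \<Sum>i\<in>UNIV. \<alpha> i *\<^sub>R \<Xi> i k))" if "time_grid T" for T
  proof -
    let ?I = "{1..card T}"
    let ?E = "\<lambda>i. energy (\<lambda>k l. g i \<bar>grid_time T k - grid_time T l\<bar>) ?I"
    have cost_eq: "cost G T \<eta> =
        1 / 2 * (\<Sum>i\<in>UNIV. ?E i (\<lambda>k. v i \<bullet> \<eta> k) (\<lambda>k. v i \<bullet> \<eta> k))" for \<eta>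
      by (rule cost_eq_sum_energy[OF v]) (rule eig)
    have "?I \<noteq> {}"
      using that by (auto simp: time_grid_def card_gt_0_iff Suc_le_eq)
    have g_eq: "g i = (\<lambda>t. v i \<bullet> (G t *v v i))" for i
      by (simp add: g_def fun_eq_iff)
    have "\<exists>x \<in> prob_simplex ?I. \<forall>y. ?E i x x * (sum y ?I)\<^sup>2 \<le> ?E i y y" for i
    proof -
      interpret maximum_principle_kernel "\<lambda>k l. g i \<bar>grid_time T k - grid_time T l\<bar>"
      proof (rule maximum_principle_convex_kernel)
        show "antimono_on {0..} (g i)"
          using \<open>nonincreasing_kernel G\<close> unfolding g_eq nonincreasing_kernel_def by (rule spec)
        show "convex_on {0..} (g i)"
          using \<open>convex_kernel G\<close> unfolding g_eq convex_kernel_def by (rule spec)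
      qed
      show ?thesis
        using ex_nonneg_energy_minimizer[of ?I] \<open>?I \<noteq> {}\<close> by (metis finite_atLeastAtMost)
    qed
    then obtain x where x: "\<And>i. x i \<in> prob_simplex ?I"
      and x_min: "\<And>i y. ?E i (x i) (x i) * (sum y ?I)\<^sup>2 \<le> ?E i y y"
      by metis
    have x_nonneg: "0 \<le> x i k" and x_sum: "sum (x i) ?I = 1" for i k
      using x[of i] by (auto simp: prob_simplex_def)
    \<comment> \<open>Liquidating \<open>v i\<close> requires the total \<open>- v i\<close>,
      whereas \<open>x i\<close> sums to 1; hence the minus sign.\<close>
    define \<Xi> where "\<Xi> = (\<lambda>i k. (- x i k) *\<^sub>R v i)"
    \<comment> \<open>All coefficients are treated at once; optimality for a single
      \<open>v i\<close> is the case of an indicator \<open>\<alpha>\<close>.\<close>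
    have opt: "optimal_strategy G T (\<Sum>i\<in>UNIV. \<alpha> i *\<^sub>R v i) (\<lambda>k. \<Sum>i\<in>UNIV. \<alpha> i *\<^sub>R \<Xi> i k)" for \<alpha>
    proof -
      let ?X = "\<Sum>i\<in>UNIV. \<alpha> i *\<^sub>R v i"
      let ?\<xi> = "\<lambda>k. \<Sum>i\<in>UNIV. \<alpha> i *\<^sub>R \<Xi> i k"
      have vX: "v i \<bullet> ?X = \<alpha> i" for i
        by (simp add: inner_sum_right vv if_distrib cong: if_cong)
      have v\<xi>: "v i \<bullet> ?\<xi> k = - \<alpha> i * x i k" for i k
        by (simp add: \<Xi>_def inner_sum_right vv if_distrib sum_negf cong: if_cong)
      have "(\<Sum>k\<in>?I. ?\<xi> k) = (\<Sum>i\<in>UNIV. \<Sum>k\<in>?I. \<alpha> i *\<^sub>R \<Xi> i k)"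
        by (rule sum.swap)
      also have "\<dots> = (\<Sum>i\<in>UNIV. (- \<alpha> i) *\<^sub>R sum (x i) ?I *\<^sub>R v i)"
        by (simp add: \<Xi>_def sum_negf scaleR_sum_left scaleR_sum_right)
      also have "\<dots> = - ?X"
        unfolding x_sum by (simp add: sum_negf)
      finally have "?\<xi> \<in> X_det T ?X"
        by (simp add: X_det_def)
      moreover have "cost G T ?\<xi> \<le> cost G T \<eta>" if "\<eta> \<in> X_det T ?X" for \<eta>
      proof -
        have "(\<Sum>k\<in>?I. \<eta> k) = - ?X"
          using that by (simp add: X_det_def eq_neg_iff_add_eq_0 add.commute)
        hence "(\<Sum>k\<in>?I. v i \<bullet> \<eta> k) = - \<alpha> i" for i
          by (metis inner_minus_right inner_sum_right vX)
        \<comment> \<open>The left side is \<open>(\<alpha> i)\<^sup>2\<close> times the energy of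
          \<open>x i\<close>, exactly the lower bound for a competitor of total
          \<open>- \<alpha> i\<close>.\<close>
        hence "?E i (\<lambda>k. v i \<bullet> ?\<xi> k) (\<lambda>k. v i \<bullet> ?\<xi> k) \<le> ?E i (\<lambda>k. v i \<bullet> \<eta> k) (\<lambda>k. v i \<bullet> \<eta> k)" for i
          using x_min[of i "\<lambda>k. v i \<bullet> \<eta> k"] by (simp only: v\<xi> energy_scale) (simp add: mult.commute)
        thus ?thesis
          unfolding cost_eq by (intro mult_left_mono sum_mono) simp_all
      qed
      ultimately show ?thesis
        by (fastforce simp: optimal_strategy_def is_arg_min_def not_less)
    qed
    have "optimal_strategy G T (v i) (\<Xi> i)" for i
      using opt[of "\<lambda>j. if j = i then 1 else 0"] by (simp add: if_distrib[of "\<lambda>c. c *\<^sub>R _"] cong: if_cong)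
    \<comment> \<open>All trades of \<open>\<Xi> i\<close> are nonpositive multiples of the one
      vector \<open>v i\<close>, so each component keeps its sign.\<close>
    moreover have "0 \<le> \<Xi> i m $ j * \<Xi> i n $ j" for i j m n
    proof -
      have "\<Xi> i m $ j * \<Xi> i n $ j = x i m * x i n * (v i $ j)\<^sup>2"
        by (simp add: \<Xi>_def power2_eq_square)
      thus ?thesis
        using x_nonneg by simp
    qed
    ultimately show ?thesis
      using opt by blast
  qed
  thus ?thesis
    using v by blast
qed

end
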